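(* If $G$ is a connected $n$-vertex graph with a $(3,2)$-cover that has the minimum possible number of edges among all connected $n$-vertex graphs with a $(3,2)$-cover, then $G$ has a $(4,1)$-cover.
   Context: A graph $G$ has a $(k,\ell)$-cover if every edge of $G$ lies in at least $\ell$ copies of $K_k$ (subgraphs isomorphic to the complete graph on $k$ vertices). Thus a $(3,2)$-cover means every edge lies in at least two triangles, and a $(4,1)$-cover means every edge lies in a copy of $K_4$. *)

theory Defs
  imports "Graph_Theory.Graph_Theory"
begin

text \<open>
  A finite simple graph is a \<^locale>\<open>pair_graph\<close>: an irreflexive symmetric set of arcs on a
  finite vertex set, so every undirected edge is represented by two opposite arcs.
\<close>

definition uedges :: "'a pair_pre_digraph \<Rightarrow> 'a set set" where
  "uedges G = {{u, v} | u v. (u, v) \<in> parcs G}"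

definition clique_copies :: "nat \<Rightarrow> 'a pair_pre_digraph \<Rightarrow> 'a pair_pre_digraph set" where
  "clique_copies k G = {H. subgraph (with_proj H) (with_proj G) \<and> K\<^bsub>k\<^esub> (with_proj H)}"

text \<open>Copies are counted as subgraphs of \<open>G\<close>, not as embeddings of the complete graph.\<close>

definition has_cover :: "nat \<Rightarrow> nat \<Rightarrow> 'a pair_pre_digraph \<Rightarrow> bool" where
  "has_cover k l G \<longleftrightarrow> (\<forall>e \<in> uedges G. l \<le> card {H \<in> clique_copies k G. e \<in> uedges H})"

text \<open>For a finite graph the cardinality in \<^const>\<open>has_cover\<close> is not the degenerate \<open>card\<close> of an infinite set.\<close>

lemma (in pair_fin_digraph) finite_clique_copies: "finite (clique_copies k G)"
proof (rule finite_subset)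
  show "clique_copies k G \<subseteq>
      (\<lambda>(V, A). \<lparr>pverts = V, parcs = A\<rparr>) ` (Pow (pverts G) \<times> Pow (parcs G))"
  proof
    fix H assume "H \<in> clique_copies k G"
    then have "(pverts H, parcs H) \<in> Pow (pverts G) \<times> Pow (parcs G)"
      by (auto simp: clique_copies_def subgraph_def)
    moreover have "H = (\<lambda>(V, A). \<lparr>pverts = V, parcs = A\<rparr>) (pverts H, parcs H)"
      by simp
    ultimately show "H \<in> (\<lambda>(V, A). \<lparr>pverts = V, parcs = A\<rparr>) ` (Pow (pverts G) \<times> Pow (parcs G))"
      by (rule rev_image_eqI)
  qed
  show "finite ((\<lambda>(V, A). \<lparr>pverts = V, parcs = A\<rparr>) ` (Pow (pverts G) \<times> Pow (parcs G)))"
    using pair_finite_verts pair_finite_arcs by auto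
qed

definition connected_cover_graph :: "nat \<Rightarrow> nat \<Rightarrow> nat \<Rightarrow> 'a pair_pre_digraph \<Rightarrow> bool" where
  "connected_cover_graph n k l G \<longleftrightarrow> pair_graph G \<and> Digraph_Component.connected (with_proj G) \<and>
     card (pverts G) = n \<and> has_cover k l G"

text \<open>
  The competitors \<open>H\<close> have vertices of the same type as \<open>G\<close>. Nothing is lost: every graph with
  as many vertices as \<open>G\<close> is isomorphic to one on the vertex set of \<open>G\<close>.
\<close>

definition min_connected_cover_graph :: "nat \<Rightarrow> nat \<Rightarrow> nat \<Rightarrow> 'a pair_pre_digraph \<Rightarrow> bool" where
  "min_connected_cover_graph n k l G \<longleftrightarrow> connected_cover_graph n k l G \<and>
     (\<forall>H :: 'a pair_pre_digraph. connected_cover_graph n k l H \<longrightarrow> card (uedges G) \<le> card (uedges H))"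

end

theory Submission
  imports Defs
begin

text \<open>
  Assign to a vertex set \<open>S\<close> the excess \<open>2 e(S) - 4 |S| + 4\<close>. Starting from a single vertex, which has
  excess \<open>0\<close>, grow a set \<open>S\<close> outside of which every vertex has at most one neighbour in \<open>S\<close>. If
  \<open>u \<in> S\<close> has a neighbour outside, then the neighbours of \<open>u\<close> outside \<open>S\<close> induce a graph of minimum
  degree at least \<open>2\<close>. Add a triangle of that graph if there is one, otherwise the whole of it, and
  then keep adding vertices with at least two neighbours in the current set. No step lowers the excess.
  In the first case the excess grows by \<open>4\<close>, or all new edges lie in copies of \<open>K\<^sub>4\<close>; in the second
  case the edges of the triangle-free graph still miss a triangle, and repairing this costs at least
  \<open>4\<close>. So either the whole graph has excess at least \<open>4\<close>, that is \<open>e \<ge> 2 n\<close>, or every edge lies in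
  a \<open>K\<^sub>4\<close>. For \<open>n \<ge> 4\<close>, gluing copies of \<open>K\<^sub>4\<close> gives a competitor with at most \<open>2 n - 1\<close> edges.
\<close>

subsection \<open>Absorbing vertices with two neighbours\<close>

context pair_graph
begin

definition nbhd :: "'a \<Rightarrow> 'a set" where
  "nbhd x = {y. (x, y) \<in> parcs G}"

lemma nbhd_sym: "y \<in> nbhd x \<longleftrightarrow> x \<in> nbhd y"
  by (auto simp: nbhd_def intro: arcs_symmetric)

lemma nbhd_irrefl [simp]: "x \<notin> nbhd x"
  by (auto simp: nbhd_def dest: no_loops')

lemma nbhd_subset: "nbhd x \<subseteq> pverts G"
  by (auto simp: nbhd_def dest: in_arcsD2)

lemma finite_nbhd [simp]: "finite (nbhd x)"
  using finite_subset[OF nbhd_subset pair_finite_verts] .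

text \<open>Arcs come in opposite pairs, so the first term is already twice the number of edges.
  Integers avoid truncated subtraction, and the constant gives a single vertex the value 0.\<close>

definition excess :: "'a set \<Rightarrow> int" where
  "excess S = int (card (parcs G \<inter> S \<times> S)) - 4 * int (card S) + 4"

text \<open>The four vertices are distinct because adjacent vertices differ.\<close>

definition in_K4 :: "'a \<Rightarrow> 'a \<Rightarrow> bool" where
  "in_K4 x y \<longleftrightarrow> y \<in> nbhd x \<and> (\<exists>z w. z \<in> nbhd x \<inter> nbhd y \<and> w \<in> nbhd x \<inter> nbhd y \<inter> nbhd z)"

lemma in_K4_sym: "in_K4 x y \<Longrightarrow> in_K4 y x"
  unfolding in_K4_def using nbhd_sym by blast

lemma clique_in_K4:
  assumes "b \<in> nbhd a" "c \<in> nbhd a" "d \<in> nbhd a" "c \<in> nbhd b" "d \<in> nbhd b" "d \<in> nbhd c"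
    and "x \<in> {a, b, c, d}" "y \<in> {a, b, c, d}" "x \<noteq> y"
  shows "in_K4 x y"
proof -
  have sym: "a \<in> nbhd b" "a \<in> nbhd c" "a \<in> nbhd d" "b \<in> nbhd c" "b \<in> nbhd d" "c \<in> nbhd d"
    using assms(1-6) nbhd_sym by blast+
  have "in_K4 a b" "in_K4 a c" "in_K4 a d" "in_K4 b c" "in_K4 b d" "in_K4 c d"
    unfolding in_K4_def using assms(1-6) sym by blast+
  then show ?thesis using assms(7-9) in_K4_sym by blast
qed

definition all_in_K4 :: "'a set \<Rightarrow> bool" where
  "all_in_K4 S \<longleftrightarrow> (\<forall>x\<in>S. \<forall>y\<in>S. y \<in> nbhd x \<longrightarrow> in_K4 x y)"

text \<open>These are the sets from which no \<open>absorb\<close> step is possible.\<close>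

definition absorbed :: "'a set \<Rightarrow> bool" where
  "absorbed S \<longleftrightarrow> (\<forall>z \<in> pverts G - S. card (nbhd z \<inter> S) \<le> 1)"

definition absorb :: "'a set \<Rightarrow> 'a set \<Rightarrow> bool" where
  "absorb S S' \<longleftrightarrow> (\<exists>z. z \<in> pverts G \<and> z \<notin> S \<and> 2 \<le> card (nbhd z \<inter> S) \<and> S' = insert z S)"

text \<open>Split the arcs by the sides of tail and head. The two mixed blocks are converses of each
  other, hence the factor 2; arcs with tail in \<open>T\<close> are counted tail by tail.\<close>

lemma card_arcs_disjoint_Un:
  assumes "finite S" "finite T" "S \<inter> T = {}"
  shows "card (parcs G \<inter> (S \<union> T) \<times> (S \<union> T)) =
    card (parcs G \<inter> S \<times> S) + 2 * (\<Sum>t\<in>T. card (nbhd t \<inter> S)) + (\<Sum>t\<in>T. card (nbhd t \<inter> T))"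
proof -
  have sig: "card (parcs G \<inter> T \<times> B) = (\<Sum>t\<in>T. card (nbhd t \<inter> B))" if "finite B" for B
  proof -
    have "parcs G \<inter> T \<times> B = Sigma T (\<lambda>t. nbhd t \<inter> B)"
      by (auto simp: nbhd_def)
    then show ?thesis using assms that by simp
  qed
  have conv: "parcs G \<inter> S \<times> T = (parcs G \<inter> T \<times> S)\<inverse>"
    by (auto intro: arcs_symmetric)
  have "parcs G \<inter> (S \<union> T) \<times> (S \<union> T) =
      ((parcs G \<inter> S \<times> S) \<union> (parcs G \<inter> S \<times> T)) \<union> ((parcs G \<inter> T \<times> S) \<union> (parcs G \<inter> T \<times> T))"
    by auto
  also have "card \<dots> = card ((parcs G \<inter> S \<times> S) \<union> (parcs G \<inter> S \<times> T)) +
      card ((parcs G \<inter> T \<times> S) \<union> (parcs G \<inter> T \<times> T))"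
    using assms by (intro card_Un_disjoint) auto
  also have "card ((parcs G \<inter> S \<times> S) \<union> (parcs G \<inter> S \<times> T)) =
      card (parcs G \<inter> S \<times> S) + card (parcs G \<inter> S \<times> T)"
    using assms by (intro card_Un_disjoint) auto
  also have "card ((parcs G \<inter> T \<times> S) \<union> (parcs G \<inter> T \<times> T)) =
      card (parcs G \<inter> T \<times> S) + card (parcs G \<inter> T \<times> T)"
    using assms by (intro card_Un_disjoint) auto
  finally show ?thesis
    using assms by (simp add: sig conv card_inverse)
qed

text \<open>A new vertex costs 4 and each of its edges into \<open>S\<close> is worth 2: two
  neighbours break even, three gain 2, four gain 4.\<close>

lemma excess_insert:
  assumes "finite S" "z \<notin> S"
  shows "excess (insert z S) = excess S + 2 * int (card (nbhd z \<inter> S)) - 4"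
  using card_arcs_disjoint_Un[of S "{z}"] assms
  by (simp add: excess_def)

lemma absorb_lastE:
  assumes "absorb\<^sup>*\<^sup>* S Q" "Q \<noteq> S"
  obtains R z where "absorb\<^sup>*\<^sup>* S R" "z \<notin> R" "2 \<le> card (nbhd z \<inter> R)" "Q = insert z R"
  using assms by (metis absorb_def rtranclp.cases)

lemma absorb_subset: "absorb\<^sup>*\<^sup>* S Q \<Longrightarrow> S \<subseteq> Q"
  by (induction rule: rtranclp_induct) (auto simp: absorb_def)

lemma absorb_subset_verts: "absorb\<^sup>*\<^sup>* S Q \<Longrightarrow> S \<subseteq> pverts G \<Longrightarrow> Q \<subseteq> pverts G"
  by (induction rule: rtranclp_induct) (auto simp: absorb_def)

lemma absorb_excess_mono:
  assumes "absorb\<^sup>*\<^sup>* S Q" "S \<subseteq> pverts G"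
  shows "excess S \<le> excess Q"
  using assms(1)
proof (induction rule: rtranclp_induct)
  case (step Q R)
  have "finite Q"
    using absorb_subset_verts[OF step.hyps(1) assms(2)] pair_finite_verts finite_subset by blast
  then show ?case
    using step by (auto simp: absorb_def excess_insert)
qed simp

lemma ex_absorbed_closure:
  assumes "S \<subseteq> pverts G"
  shows "\<exists>Q. absorb\<^sup>*\<^sup>* S Q \<and> absorbed Q"
  using assms
proof (induction "card (pverts G - S)" arbitrary: S rule: less_induct)
  case less
  show ?case
  proof (cases "absorbed S")
    case True
    then show ?thesis by blast
  next
    case False
    then obtain z where z: "z \<in> pverts G" "z \<notin> S" "2 \<le> card (nbhd z \<inter> S)"
      by (auto simp: absorbed_def not_le)
    then have step: "absorb S (insert z S)" by (auto simp: absorb_def)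
    have "card (pverts G - insert z S) < card (pverts G - S)"
      using z pair_finite_verts by (intro psubset_card_mono) auto
    then obtain Q where "absorb\<^sup>*\<^sup>* (insert z S) Q" "absorbed Q"
      using less z by blast
    then show ?thesis using step by (meson converse_rtranclp_into_rtranclp)
  qed
qed

text \<open>A common neighbour outside \<open>Q\<close> would have the two distinct neighbours
  \<open>x\<close> and \<open>y\<close> in \<open>Q\<close>.\<close>

lemma absorbed_common_nbhd:
  assumes "absorbed Q" "x \<in> Q" "y \<in> Q" "y \<in> nbhd x"
  shows "nbhd x \<inter> nbhd y \<subseteq> Q"
proof
  fix z assume z: "z \<in> nbhd x \<inter> nbhd y"
  show "z \<in> Q"
  proof (rule ccontr)
    assume "z \<notin> Q"
    then have "card (nbhd z \<inter> Q) \<le> 1"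
      using assms(1) z nbhd_subset by (auto simp: absorbed_def)
    moreover have "{x, y} \<subseteq> nbhd z \<inter> Q"
      using z assms by (auto simp: nbhd_sym)
    then have "card {x, y} \<le> card (nbhd z \<inter> Q)" by (intro card_mono) auto
    ultimately show False using assms(4) by (cases "x = y") auto
  qed
qed

end

section \<open>Absorption when every edge lies in two triangles\<close>

locale double_triangle_graph = pair_graph G for G :: "'a pair_pre_digraph" +
  assumes two_triangles: "y \<in> pair_graph.nbhd G x \<Longrightarrow> 2 \<le> card (pair_graph.nbhd G x \<inter> pair_graph.nbhd G y)"
begin

text \<open>Besides \<open>p\<close> itself, its common neighbours with \<open>w\<close>, at least
  two, all lie in \<open>Q\<close>.\<close>

lemma three_nbhd:
  assumes "w \<notin> Q" "p \<in> Q" "p \<in> nbhd w" "nbhd w \<inter> nbhd p \<subseteq> insert w Q"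
  shows "3 \<le> card (nbhd w \<inter> Q)"
proof -
  have "insert p (nbhd w \<inter> nbhd p) \<subseteq> nbhd w \<inter> Q" using assms by auto
  then have "card (insert p (nbhd w \<inter> nbhd p)) \<le> card (nbhd w \<inter> Q)"
    by (intro card_mono) auto
  then show ?thesis using two_triangles[OF assms(3)] by simp
qed

text \<open>A triangle on the edge from \<open>z\<close> to one of \<open>a\<close>,
  \<open>b\<close>, \<open>c\<close> has its third vertex among the other two. Two triangles are
  required, so both occur, and \<open>z\<close>, \<open>a\<close>, \<open>b\<close>,
  \<open>c\<close> form a K4.\<close>

lemma three_nbhd_clique:
  assumes "z \<notin> Q" "absorbed (insert z Q)" "nbhd z \<inter> Q = {a, b, c}" "card {a, b, c} = 3"
  shows "b \<in> nbhd a \<and> c \<in> nbhd a \<and> c \<in> nbhd b"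
proof -
  have eq: "nbhd z \<inter> nbhd x = {a, b, c} - {x}" if x: "x \<in> {a, b, c}" for x
  proof (rule card_subset_eq)
    have xz: "x \<in> nbhd z" "x \<in> Q" using assms(3) x by blast+
    have "nbhd z \<inter> nbhd x \<subseteq> insert z Q"
      using absorbed_common_nbhd[OF assms(2)] xz by auto
    then show "nbhd z \<inter> nbhd x \<subseteq> {a, b, c} - {x}"
      using assms(3) nbhd_irrefl by blast
    then have "card (nbhd z \<inter> nbhd x) \<le> card ({a, b, c} - {x})" by (intro card_mono) auto
    moreover have "card ({a, b, c} - {x}) = 2" using assms(4) x by simp
    ultimately show "card (nbhd z \<inter> nbhd x) = card ({a, b, c} - {x})"
      using two_triangles[OF xz(1)] by simp
  qed simp
  have "a \<noteq> b" "a \<noteq> c" "b \<noteq> c" using assms(4) by (auto simp: card_insert_if split: if_splits)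
  then show ?thesis using eq[of a] eq[of b] by auto
qed

text \<open>
  Every edge inside \<open>Q\<close> has all its triangles in \<open>Q\<close>. Hence the last absorbed vertex has at least
  three neighbours, and a further vertex absorbed with exactly two neighbours can only come
  immediately before it, forming a \<open>K\<^sub>4\<close> with it. The set \<open>A\<close> consists of the neighbours in \<open>S\<close> of the
  absorbed vertices.
\<close>

lemma absorption:
  assumes "S \<subseteq> pverts G" "absorb\<^sup>*\<^sup>* S Q" "absorbed Q" "Q \<noteq> S"
  obtains (large) "excess Q \<ge> excess S + 4"
  | (small) A where "excess Q \<ge> excess S + 2" "card A \<le> 3" "finite A"
      "\<And>x y. x \<in> Q \<Longrightarrow> y \<in> nbhd x \<Longrightarrow> y \<in> Q \<Longrightarrow> x \<notin> S \<or> y \<notin> S \<Longrightarrow> in_K4 x y"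
      "\<And>x y. x \<in> S \<Longrightarrow> y \<in> nbhd x \<Longrightarrow> y \<in> S \<Longrightarrow> \<not> {x, y} \<subseteq> A \<Longrightarrow> nbhd x \<inter> nbhd y \<subseteq> S"
proof -
  have fin: "finite R" if "absorb\<^sup>*\<^sup>* S R" for R
    using absorb_subset_verts[OF that assms(1)] pair_finite_verts finite_subset by blast
  obtain R z where R: "absorb\<^sup>*\<^sup>* S R" "z \<notin> R" "2 \<le> card (nbhd z \<inter> R)" and Q: "Q = insert z R"
    using assms(2,4) by (rule absorb_lastE)
  have exQ: "excess Q = excess R + 2 * int (card (nbhd z \<inter> R)) - 4"
    using excess_insert fin R Q by simp
  have exR: "excess S \<le> excess R" using absorb_excess_mono R(1) assms(1) by blast
  have common: "nbhd x \<inter> nbhd y \<subseteq> Q" if "x \<in> Q" "y \<in> Q" "y \<in> nbhd x" for x y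
    using absorbed_common_nbhd assms(3) that by blast
  from R(3) have "nbhd z \<inter> R \<noteq> {}" by auto
  then obtain p where p: "p \<in> nbhd z" "p \<in> R" by blast
  have three: "3 \<le> card (nbhd z \<inter> R)"
    using three_nbhd[OF R(2) p(2,1)] common[of z p] p Q by simp
  show thesis
  proof (cases "card (nbhd z \<inter> R) = 3")
    case False
    \<comment> \<open>With at least four neighbours, \<open>z\<close> alone gains
      \<open>2 * 4 - 4\<close>.\<close>
    then show thesis using large three exQ exR by simp
  next
    case card3: True
    then obtain a b c where abc: "nbhd z \<inter> R = {a, b, c}" "card {a, b, c} = 3"
      by (metis card_3_iff)
    note clq = three_nbhd_clique[OF R(2) assms(3)[unfolded Q] abc]
    show thesis
    proof (cases "R = S")
      case True
      \<comment> \<open>Only \<open>z\<close> was absorbed, and its neighbours in \<open>S\<close>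
        are exactly \<open>a\<close>, \<open>b\<close>, \<open>c\<close>. An edge of
        \<open>S\<close> not inside this witness therefore has no triangle through
        \<open>z\<close>.\<close>
      show thesis
      proof (rule small[of "{a, b, c}"])
        show "excess Q \<ge> excess S + 2" using exQ card3 True by simp
        show "card {a, b, c} \<le> 3" using abc by simp
        have K: "in_K4 z y" if "y \<in> nbhd z" "y \<in> Q" for y
        proof -
          have "y \<in> nbhd z \<inter> R" using that Q by auto
          then have y: "y \<in> {a, b, c}" using abc by simp
          have "a \<in> nbhd z" "b \<in> nbhd z" "c \<in> nbhd z" using abc by blast+
          then show ?thesis
            using y clq that by (intro clique_in_K4[of a z b c]) auto
        qed
        show "in_K4 x y" if "x \<in> Q" "y \<in> nbhd x" "y \<in> Q" "x \<notin> S \<or> y \<notin> S" for x y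
        proof -
          have "x = z \<or> y = z" using that Q True by auto
          then show ?thesis using K that in_K4_sym nbhd_sym by metis
        qed
        show "nbhd x \<inter> nbhd y \<subseteq> S" if "x \<in> S" "y \<in> nbhd x" "y \<in> S" "\<not> {x, y} \<subseteq> {a, b, c}" for x y
        proof -
          have "z \<notin> nbhd x \<inter> nbhd y" using that abc True nbhd_sym by blast
          then show ?thesis using common[of x y] that Q True by auto
        qed
      qed simp
    next
      case False
      obtain T y where T: "absorb\<^sup>*\<^sup>* S T" "y \<notin> T" "2 \<le> card (nbhd y \<inter> T)" and R': "R = insert y T"
        using R(1) False by (rule absorb_lastE)
      have exR': "excess R = excess T + 2 * int (card (nbhd y \<inter> T)) - 4"
        using excess_insert fin T R' by simp
      have exT: "excess S \<le> excess T" using absorb_excess_mono T(1) assms(1) by blast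
      show thesis
      proof (cases "card (nbhd y \<inter> T) = 2")
        case False
        \<comment> \<open>Three or more neighbours of \<open>y\<close> gain at least 2, which with
          the 2 gained by \<open>z\<close> makes 4.\<close>
        then show thesis using large T(3) exQ exR' exT card3 by simp
      next
        case card2: True
        then obtain p q where pq: "nbhd y \<inter> T = {p, q}" "p \<noteq> q"
          by (metis card_2_iff)
        have zy: "z \<noteq> y" "y \<notin> T" "z \<notin> T" using T R R' by auto
        have pqz: "p \<noteq> z" "q \<noteq> z" using pq(1) zy by blast+
        \<comment> \<open>Triangles on an edge from \<open>y\<close> to \<open>p\<close> or
          \<open>q\<close> can only use \<open>z\<close> and the other one of \<open>p\<close>,
          \<open>q\<close>. Both must occur, so \<open>y\<close>, \<open>z\<close>,
          \<open>p\<close>, \<open>q\<close> form a K4.\<close>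
        have full: "nbhd y \<inter> nbhd x = {p, q, z} - {x}" if x: "x \<in> {p, q}" for x
        proof -
          have xy: "x \<in> nbhd y" "x \<in> T" using pq x by blast+
          have "nbhd y \<inter> nbhd x \<subseteq> insert z (insert y T)"
            using common[of y x] xy Q R' by simp
          then have sub: "nbhd y \<inter> nbhd x \<subseteq> {p, q, z} - {x}"
            using pq(1) nbhd_irrefl by blast
          have "card {p, q, z} = 3" using pq(2) pqz by simp
          then have "card ({p, q, z} - {x}) = 2" using x by (subst card_Diff_singleton) auto
          then have "card (nbhd y \<inter> nbhd x) = card ({p, q, z} - {x})"
            using two_triangles[OF xy(1)] card_mono[OF _ sub] by simp
          then show ?thesis using sub by (intro card_subset_eq) auto
        qed
        have adj: "z \<in> nbhd y" "z \<in> nbhd p" "q \<in> nbhd p" "z \<in> nbhd q"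
          using full[of p] full[of q] pq(2) pqz by auto
        have py: "p \<in> nbhd y" "q \<in> nbhd y" "p \<in> T" "q \<in> T" using pq by blast+
        \<comment> \<open>\<open>z\<close> has exactly three neighbours in \<open>R\<close>, and
          \<open>p\<close>, \<open>q\<close>, \<open>y\<close> are three of them.\<close>
        have zR: "nbhd z \<inter> R = {p, q, y}"
        proof (rule card_subset_eq[symmetric])
          show "{p, q, y} \<subseteq> nbhd z \<inter> R" using adj py R' nbhd_sym by blast
          have "p \<noteq> y" "q \<noteq> y" using py zy by blast+
          then have "card {p, q, y} = 3" using pq(2) by simp
          then show "card {p, q, y} = card (nbhd z \<inter> R)" using card3 by simp
        qed simp
        \<comment> \<open>Inside \<open>T\<close>, both \<open>y\<close> and \<open>z\<close> are
          adjacent to \<open>p\<close> and \<open>q\<close> only, so absorbing them creates no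
          triangle on any edge of \<open>T\<close> other than \<open>pq\<close>.\<close>
        have yz_only: "y \<notin> nbhd x \<inter> nbhd x' \<and> z \<notin> nbhd x \<inter> nbhd x'"
          if "x \<in> T" "x' \<in> T" "\<not> {x, x'} \<subseteq> {p, q}" for x x'
        proof -
          have "\<not> {x, x'} \<subseteq> nbhd y" using that pq by blast
          moreover have "\<not> {x, x'} \<subseteq> nbhd z" using that zR R' zy by blast
          ultimately show ?thesis using nbhd_sym by blast
        qed
        have common': "nbhd x \<inter> nbhd x' \<subseteq> T"
          if "x \<in> T" "x' \<in> T" "x' \<in> nbhd x" "\<not> {x, x'} \<subseteq> {p, q}" for x x'
          using common[of x x'] yz_only[of x x'] that Q R' by auto
        show thesis
        proof (cases "T = S")
          case True
          show thesis
          proof (rule small[of "{p, q}"])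
            show "excess Q \<ge> excess S + 2" using exQ exR' card3 card2 True by simp
            show "card {p, q} \<le> 3" by (simp add: card_insert_if)
            show "in_K4 x x'" if "x \<in> Q" "x' \<in> nbhd x" "x' \<in> Q" "x \<notin> S \<or> x' \<notin> S" for x x'
            proof -
              \<comment> \<open>All neighbours of \<open>y\<close> and \<open>z\<close> in
                \<open>Q\<close> lie in the K4 on \<open>p\<close>, \<open>y\<close>,
                \<open>q\<close>, \<open>z\<close>.\<close>
              have K: "in_K4 v x" if v: "v \<in> {y, z}" "x \<in> nbhd v" "x \<in> Q" for v x
              proof -
                have "x \<in> nbhd y \<inter> T \<or> x = z \<or> x \<in> nbhd z \<inter> R" using v Q R' by auto
                then have "x \<in> {y, p, q, z}" using pq zR by auto
                moreover have "x \<noteq> v" using v by auto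
                ultimately show ?thesis
                  using v adj py by (intro clique_in_K4[of p y q z]) auto
              qed
              have "x \<in> {y, z} \<or> x' \<in> {y, z}" using that Q R' True by auto
              then show ?thesis using K that in_K4_sym nbhd_sym by metis
            qed
          qed (use common' True in auto)
        next
          case False
          obtain U w where U: "absorb\<^sup>*\<^sup>* S U" "w \<notin> U" "2 \<le> card (nbhd w \<inter> U)" and T': "T = insert w U"
            using T(1) False by (rule absorb_lastE)
          \<comment> \<open>Of the two or more edges from \<open>w\<close> into \<open>U\<close>, at
            most one is \<open>pq\<close>. Any other edge \<open>wv\<close> has its triangles inside
            \<open>T\<close>, so \<open>w\<close> has three neighbours in \<open>U\<close> and gains
            2. The gains of \<open>w\<close>, \<open>y\<close>, \<open>z\<close> then sum to at
            least 2 + 0 + 2.\<close>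
          have "\<not> nbhd w \<inter> U \<subseteq> {p, q}" if w: "w \<in> {p, q}"
          proof
            assume "nbhd w \<inter> U \<subseteq> {p, q}"
            then have "nbhd w \<inter> U \<subseteq> {p, q} - {w}" using U(2) by blast
            then have "card (nbhd w \<inter> U) \<le> card ({p, q} - {w})" by (intro card_mono) auto
            then show False using w pq(2) U(3) by auto
          qed
          moreover have "nbhd w \<inter> U \<noteq> {}" using U(3) by auto
          ultimately obtain v where v: "v \<in> nbhd w" "v \<in> U" "\<not> {w, v} \<subseteq> {p, q}" by blast
          have "nbhd w \<inter> nbhd v \<subseteq> insert w U" using common'[of w v] v T' by auto
          then have "3 \<le> card (nbhd w \<inter> U)" using three_nbhd[OF U(2) v(2,1)] by simp
          moreover have "excess T = excess U + 2 * int (card (nbhd w \<inter> U)) - 4"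
            using excess_insert fin U T' by simp
          moreover have "excess S \<le> excess U" using absorb_excess_mono U(1) assms(1) by blast
          ultimately show thesis using large exQ exR' card3 card2 by simp
        qed
      qed
    qed
  qed
qed

section \<open>Growing an absorbed set through the neighbourhood of one vertex\<close>

lemma absorbed_nbhd_eq:
  assumes "absorbed S" "u \<in> S" "t \<in> nbhd u" "t \<notin> S"
  shows "nbhd t \<inter> S = {u}"
proof -
  have "u \<in> nbhd t \<inter> S" using assms nbhd_sym by blast
  moreover have "card (nbhd t \<inter> S) \<le> 1"
    using assms nbhd_subset unfolding absorbed_def by blast
  then have "x = y" if "x \<in> nbhd t \<inter> S" "y \<in> nbhd t \<inter> S" for x y
    using that by (auto simp: card_le_Suc0_iff_eq)
  ultimately show ?thesis by blast
qed

text \<open>Each vertex of \<open>T\<close> has one edge into \<open>S\<close>, namely to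
  \<open>u\<close>, and degree at least 2 in \<open>T\<close>. So at least \<open>2 * card T\<close>
  edges are new, worth 4 per added vertex, which pays for the vertices.\<close>

lemma excess_star_Un:
  assumes "S \<subseteq> pverts G" "absorbed S" "u \<in> S" "T \<subseteq> nbhd u - S"
    and "\<And>t. t \<in> T \<Longrightarrow> 2 \<le> card (nbhd t \<inter> T)"
  shows "excess S \<le> excess (S \<union> T)"
proof -
  have fin: "finite S" "finite T"
    using assms(1,4) pair_finite_verts finite_nbhd finite_subset by blast+
  have disj: "S \<inter> T = {}" using assms(4) by blast
  have "card (nbhd t \<inter> S) = 1" if "t \<in> T" for t
    using absorbed_nbhd_eq[OF assms(2,3), of t] assms(4) that by auto
  then have "(\<Sum>t\<in>T. card (nbhd t \<inter> S)) = card T" by simp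
  moreover have "2 * card T \<le> (\<Sum>t\<in>T. card (nbhd t \<inter> T))"
    using sum_mono[of T "\<lambda>_. 2" "\<lambda>t. card (nbhd t \<inter> T)"] assms(5) by simp
  ultimately show ?thesis
    using card_arcs_disjoint_Un[OF fin disj] card_Un_disjoint[OF fin disj]
    unfolding excess_def by linarith
qed

lemma extend_absorbed:
  assumes S: "S \<subseteq> pverts G" "absorbed S" "excess S \<ge> 0" "excess S \<ge> 4 \<or> all_in_K4 S"
    and u: "u \<in> S" and v: "v \<in> nbhd u" "v \<notin> S"
  obtains Q where "Q \<subseteq> pverts G" "S \<subset> Q" "absorbed Q" "excess Q \<ge> 0" "excess Q \<ge> 4 \<or> all_in_K4 Q"
proof -
  define T where "T = nbhd u - S"
  have TS: "x = u" if "t \<in> T" "x \<in> nbhd t" "x \<in> S" for t x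
    using absorbed_nbhd_eq[OF S(2) u, of t] that unfolding T_def by blast
  \<comment> \<open>\<open>u\<close> is the only neighbour of \<open>t\<close> in \<open>S\<close>,
    so the third vertex of any triangle on \<open>ut\<close> is again in \<open>T\<close>.\<close>
  have deg: "2 \<le> card (nbhd t \<inter> T)" if t: "t \<in> T" for t
  proof -
    have "nbhd u \<inter> nbhd t \<subseteq> nbhd t \<inter> T"
      using TS[OF t] t nbhd_irrefl[of u] unfolding T_def by blast
    then have "card (nbhd u \<inter> nbhd t) \<le> card (nbhd t \<inter> T)" by (intro card_mono) auto
    then show ?thesis using two_triangles[of t u] t T_def by simp
  qed
  show thesis
  proof (cases "\<exists>x\<in>T. \<exists>y\<in>T. \<exists>z\<in>T. y \<in> nbhd x \<and> z \<in> nbhd x \<and> z \<in> nbhd y")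
    case True
    then obtain x y z where xyz: "x \<in> T" "y \<in> T" "z \<in> T" "y \<in> nbhd x" "z \<in> nbhd x" "z \<in> nbhd y"
      by blast
    define S' where "S' = S \<union> {x, y, z}"
    have S': "S' \<subseteq> pverts G" "S \<subset> S'"
      using S(1) xyz nbhd_subset unfolding S'_def T_def by blast+
    have sym: "x \<in> nbhd y" "x \<in> nbhd z" "y \<in> nbhd z" using xyz nbhd_sym by blast+
    have ne: "x \<noteq> y" "x \<noteq> z" "y \<noteq> z" using xyz nbhd_irrefl by blast+
    have "2 \<le> card (nbhd t \<inter> {x, y, z})" if t: "t \<in> {x, y, z}" for t
    proof -
      have "{x, y, z} - {t} \<subseteq> nbhd t \<inter> {x, y, z}" using t sym xyz by blast
      then have "card ({x, y, z} - {t}) \<le> card (nbhd t \<inter> {x, y, z})" by (intro card_mono) auto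
      moreover have "card ({x, y, z} - {t}) = 2"
        using t ne by (subst card_Diff_singleton) auto
      ultimately show ?thesis by simp
    qed
    then have ex: "excess S \<le> excess S'"
      unfolding S'_def using xyz by (intro excess_star_Un[OF S(1,2) u]) (auto simp: T_def)
    \<comment> \<open>The only neighbour of \<open>x\<close>, \<open>y\<close>, \<open>z\<close> in
      \<open>S\<close> is \<open>u\<close>, so every new edge lies in the clique on
      \<open>u\<close>, \<open>x\<close>, \<open>y\<close>, \<open>z\<close>.\<close>
    have K4: "in_K4 p q" if "p \<in> S'" "q \<in> S'" "q \<in> nbhd p" "p \<notin> S \<or> q \<notin> S" for p q
    proof -
      have *: "q \<in> insert u {x, y, z}" if "p \<in> {x, y, z}" "q \<in> S'" "q \<in> nbhd p" for p q
        using that TS xyz unfolding S'_def by blast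
      have "p \<in> {x, y, z} \<or> q \<in> {x, y, z}" using that S'_def by blast
      then have "p \<in> {u, x, y, z}" "q \<in> {u, x, y, z}"
        using *[of p q] *[of q p] that nbhd_sym by blast+
      moreover have "p \<noteq> q" using that by auto
      ultimately show ?thesis
        using xyz unfolding T_def by (intro clique_in_K4[of x u y z p q]) auto
    qed
    obtain Q where Q: "absorb\<^sup>*\<^sup>* S' Q" "absorbed Q" using ex_absorbed_closure[OF S'(1)] by blast
    have QV: "Q \<subseteq> pverts G" "S \<subset> Q" "excess S' \<le> excess Q"
      using absorb_subset_verts[OF Q(1) S'(1)] absorb_subset[OF Q(1)] S'(2)
        absorb_excess_mono[OF Q(1) S'(1)] by auto
    have "excess Q \<ge> 4 \<or> all_in_K4 Q"
    proof (cases "excess S \<ge> 4")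
      case True
      then show ?thesis using QV ex by simp
    next
      case False
      then have good: "all_in_K4 S'" using S(4) K4 unfolding all_in_K4_def by blast
      show ?thesis
      proof (cases "Q = S'")
        case True
        then show ?thesis using good by simp
      next
        case False
        show ?thesis
        \<comment> \<open>A large gain lifts the nonnegative excess to 4; a small one comes with all
          newly absorbed edges in copies of K4.\<close>
        proof (rule absorption[OF S'(1) Q False])
          assume "excess S' + 4 \<le> excess Q"
          then show ?thesis using S(3) ex by simp
        next
          assume "\<And>x y. x \<in> Q \<Longrightarrow> y \<in> nbhd x \<Longrightarrow> y \<in> Q \<Longrightarrow> x \<notin> S' \<or> y \<notin> S' \<Longrightarrow> in_K4 x y"
          then show ?thesis using good unfolding all_in_K4_def by blast
        qed
      qed
    qed
    moreover have "excess Q \<ge> 0" using S(3) ex QV(3) by simp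
    ultimately show thesis using that QV Q(2) by blast
  next
    case no_triangle: False
    define S' where "S' = S \<union> T"
    have S': "S' \<subseteq> pverts G" "S \<subset> S'"
      using S(1) v nbhd_subset unfolding S'_def T_def by blast+
    have ex: "excess S \<le> excess S'"
      unfolding S'_def using deg by (intro excess_star_Un[OF S(1,2) u]) (auto simp: T_def)
    have vT: "v \<in> T" using v T_def by blast
    obtain Q where Q: "absorb\<^sup>*\<^sup>* S' Q" "absorbed Q" using ex_absorbed_closure[OF S'(1)] by blast
    have QV: "Q \<subseteq> pverts G" "S \<subset> Q"
      using absorb_subset_verts[OF Q(1) S'(1)] absorb_subset[OF Q(1)] S'(2) by auto
    \<comment> \<open>As \<open>T\<close> is triangle-free, \<open>u\<close> is the only possible
      common neighbour of \<open>x\<close> and \<open>y\<close> in \<open>S'\<close>. The second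
      triangle leaves \<open>S'\<close>, so \<open>S'\<close> cannot be absorbed.\<close>
    have common: "\<not> nbhd x \<inter> nbhd y \<subseteq> S'" if "x \<in> T" "y \<in> T" "y \<in> nbhd x" for x y
    proof
      assume "nbhd x \<inter> nbhd y \<subseteq> S'"
      then have "nbhd x \<inter> nbhd y \<subseteq> {u}"
        using TS[OF that(1)] no_triangle that unfolding S'_def by blast
      then have "card (nbhd x \<inter> nbhd y) \<le> card {u}" by (intro card_mono) auto
      then show False using two_triangles[OF that(3)] by simp
    qed
    have nonempty: "nbhd x \<inter> T \<noteq> {}" if "x \<in> T" for x using deg[OF that] by auto
    have "Q \<noteq> S'"
    proof
      assume eq: "Q = S'"
      obtain w where w: "w \<in> nbhd v" "w \<in> T" using nonempty[OF vT] by blast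
      then show False
        using common[OF vT w(2,1)] absorbed_common_nbhd[OF Q(2), of v w] vT eq unfolding S'_def by blast
    qed
    then have "excess Q \<ge> excess S' + 4"
    proof (rule absorption[OF S'(1) Q])
      \<comment> \<open>To exclude the small gain: every edge of \<open>T\<close> lacks a triangle
        in \<open>S'\<close>, so it lies inside \<open>A\<close>, and hence so does all of
        \<open>T\<close>. With at most three vertices and minimum degree 2, \<open>T\<close> would
        have to be a triangle.\<close>
      fix A assume A: "card A \<le> 3" "finite A"
        and rest: "\<And>x y. x \<in> S' \<Longrightarrow> y \<in> nbhd x \<Longrightarrow> y \<in> S' \<Longrightarrow> \<not> {x, y} \<subseteq> A \<Longrightarrow> nbhd x \<inter> nbhd y \<subseteq> S'"
      have pair: "x \<in> A \<and> y \<in> A" if "x \<in> T" "y \<in> T" "y \<in> nbhd x" for x y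
        using rest[of x y] common[OF that] that unfolding S'_def by blast
      have "T \<subseteq> A" using pair nonempty by blast
      moreover have "2 \<le> card (nbhd v \<inter> T)" using deg[OF vT] .
      then obtain x y where xy: "x \<in> nbhd v \<inter> T" "y \<in> nbhd v \<inter> T" "x \<noteq> y"
        by (metis card_le_Suc0_iff_eq finite_Int finite_nbhd not_less_eq_eq numeral_2_eq_2)
      moreover have "v \<noteq> x" "v \<noteq> y" using xy nbhd_irrefl by blast+
      ultimately have "card {v, x, y} = 3" "{v, x, y} \<subseteq> A" using vT by auto
      then have "A = {v, x, y}" using A card_seteq by metis
      then have "nbhd x \<inter> T \<subseteq> {v, y}"
        using \<open>T \<subseteq> A\<close> nbhd_irrefl[of x] by blast
      moreover have "y \<notin> nbhd x" using no_triangle xy vT by blast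
      ultimately have "nbhd x \<inter> T \<subseteq> {v}" by blast
      then have "card (nbhd x \<inter> T) \<le> card {v}" by (intro card_mono) auto
      then show ?thesis using deg[of x] xy by simp
    qed
    then show thesis using that[OF QV Q(2)] S(3) ex by simp
  qed
qed

text \<open>Connectivity supplies an edge leaving any proper absorbed set, so the growth step
  repeats, starting from a single vertex, until the vertex set is exhausted.\<close>

lemma excess_ge_4_or_all_in_K4:
  assumes conn: "\<And>S. S \<subseteq> pverts G \<Longrightarrow> S \<noteq> {} \<Longrightarrow> S \<noteq> pverts G \<Longrightarrow> \<exists>x\<in>S. \<exists>y. y \<in> nbhd x \<and> y \<notin> S"
    and "pverts G \<noteq> {}"
  shows "excess (pverts G) \<ge> 4 \<or> all_in_K4 (pverts G)"
proof -
  have *: "excess (pverts G) \<ge> 4 \<or> all_in_K4 (pverts G)"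
    if "S \<subseteq> pverts G" "S \<noteq> {}" "absorbed S" "excess S \<ge> 0" "excess S \<ge> 4 \<or> all_in_K4 S" for S
    using that
  proof (induction "card (pverts G - S)" arbitrary: S rule: less_induct)
    case less
    show ?case
    proof (cases "S = pverts G")
      case True
      then show ?thesis using less.prems by simp
    next
      case False
      then obtain x y where xy: "x \<in> S" "y \<in> nbhd x" "y \<notin> S" using conn less.prems by metis
      obtain Q where Q: "Q \<subseteq> pverts G" "S \<subset> Q" "absorbed Q" "excess Q \<ge> 0"
        "excess Q \<ge> 4 \<or> all_in_K4 Q"
        using extend_absorbed[OF less.prems(1,3-5) xy] .
      have "card (pverts G - Q) < card (pverts G - S)"
        using Q(1,2) pair_finite_verts by (intro psubset_card_mono) auto
      then show ?thesis using less.hyps[of Q] Q by blast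
    qed
  qed
  obtain v where v: "v \<in> pverts G" using assms(2) by blast
  have "absorbed {v}"
    unfolding absorbed_def using card_mono[of "{v}"] by fastforce
  moreover have "parcs G \<inter> {v} \<times> {v} = {}" by (auto dest: no_loops')
  then have "excess {v} = 0" by (simp add: excess_def)
  moreover have "all_in_K4 {v}" by (simp add: all_in_K4_def)
  ultimately show ?thesis using *[of "{v}"] v by simp
qed

end


subsection \<open>Covers in terms of neighbourhoods\<close>

context pair_graph
begin

text \<open>A walk cannot leave a set without outgoing edges, and the set reachable from a vertex
  has none. The arcs are symmetric, so taking the symmetric closure changes nothing.\<close>

lemma connected_iff_no_cut:
  "Digraph_Component.connected (with_proj G) \<longleftrightarrow>
    pverts G \<noteq> {} \<and>
    (\<forall>S \<subseteq> pverts G. S \<noteq> {} \<longrightarrow> S \<noteq> pverts G \<longrightarrow> (\<exists>x\<in>S. \<exists>y. y \<in> nbhd x \<and> y \<notin> S))"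
proof -
  have "(parcs G)\<^sup>s = parcs G" by (auto simp: symcl_def intro: arcs_symmetric)
  then have conn: "Digraph_Component.connected (with_proj G) \<longleftrightarrow>
      pverts G \<noteq> {} \<and> (\<forall>u\<in>pverts G. \<forall>v\<in>pverts G. u \<rightarrow>\<^sup>*\<^bsub>with_proj G\<^esub> v)"
    by (simp add: connected_conv reachable_def)
  show ?thesis
  proof (intro iffI conjI allI impI)
    fix S assume c: "Digraph_Component.connected (with_proj G)"
      and S: "S \<subseteq> pverts G" "S \<noteq> {}" "S \<noteq> pverts G"
    obtain u v where uv: "u \<in> S" "v \<in> pverts G" "v \<notin> S" using S by blast
    show "\<exists>x\<in>S. \<exists>y. y \<in> nbhd x \<and> y \<notin> S"
    proof (rule ccontr)
      assume no: "\<not> ?thesis"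
      have "u \<rightarrow>\<^sup>*\<^bsub>with_proj G\<^esub> v" using c conn uv S by blast
      then have "v \<in> S"
      proof (induction rule: reachable_induct)
        case base
        then show ?case using uv by simp
      next
        case (step x y)
        then show ?case using no by (auto simp: nbhd_def)
      qed
      then show False using uv by simp
    qed
  next
    assume c: "pverts G \<noteq> {} \<and>
      (\<forall>S \<subseteq> pverts G. S \<noteq> {} \<longrightarrow> S \<noteq> pverts G \<longrightarrow> (\<exists>x\<in>S. \<exists>y. y \<in> nbhd x \<and> y \<notin> S))"
    have "u \<rightarrow>\<^sup>*\<^bsub>with_proj G\<^esub> v" if "u \<in> pverts G" "v \<in> pverts G" for u v
    proof -
      define S where "S = {x \<in> pverts G. u \<rightarrow>\<^sup>*\<^bsub>with_proj G\<^esub> x}"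
      have "\<not> (\<exists>x\<in>S. \<exists>y. y \<in> nbhd x \<and> y \<notin> S)"
      proof
        assume "\<exists>x\<in>S. \<exists>y. y \<in> nbhd x \<and> y \<notin> S"
        then obtain x y where xy: "u \<rightarrow>\<^sup>*\<^bsub>with_proj G\<^esub> x" "y \<in> nbhd x" "y \<notin> S"
          unfolding S_def by blast
        have "(x, y) \<in> parcs G" using xy(2) by (simp add: nbhd_def)
        with xy(1) have "u \<rightarrow>\<^sup>*\<^bsub>with_proj G\<^esub> y" by (rule reachable_adj_trans)
        moreover have "y \<in> pverts G" using xy(2) nbhd_subset by blast
        ultimately show False using xy(3) S_def by simp
      qed
      moreover have "S \<subseteq> pverts G" "u \<in> S" using that by (auto simp: S_def)
      ultimately have "S = pverts G" using c by blast
      then show ?thesis using that S_def by blast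
    qed
    then show "Digraph_Component.connected (with_proj G)" using conn c by blast
  qed (use conn in auto)
qed

end

text \<open>The arc set of the complete graph on \<open>A\<close>.\<close>

definition offdiag :: "'a set \<Rightarrow> 'a rel" where
  "offdiag A = {(x, y). x \<in> A \<and> y \<in> A \<and> x \<noteq> y}"

lemma card_offdiag:
  assumes "finite A"
  shows "card (offdiag A) + card A = card A * card A"
proof -
  have "A \<times> A = offdiag A \<union> Id_on A" "offdiag A \<inter> Id_on A = {}" "finite (offdiag A)"
    using finite_subset[of "offdiag A" "A \<times> A"] assms by (auto simp: offdiag_def)
  moreover have "Id_on A = (\<lambda>x. (x, x)) ` A" by auto
  then have "card (Id_on A) = card A" "finite (Id_on A)"
    using assms by (auto simp: card_image inj_on_def)
  ultimately show ?thesis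
    by (metis card_Un_disjoint card_cartesian_product)
qed

lemma finite_offdiag: "finite A \<Longrightarrow> finite (offdiag A)"
  using finite_subset[of "offdiag A" "A \<times> A"] by (auto simp: offdiag_def)

section \<open>Counting edges and clique copies\<close>

context pair_graph
begin

lemma card_parcs: "card (parcs G) = 2 * card (uedges G)"
proof -
  have eq: "parcs G = (\<Union>e\<in>uedges G. {(x, y). {x, y} = e})"
    by (auto simp: uedges_def doubleton_eq_iff intro: arcs_symmetric)
  have fin: "finite (uedges G)"
  proof (rule finite_subset)
    show "uedges G \<subseteq> (\<lambda>(x, y). {x, y}) ` parcs G" by (auto simp: uedges_def)
  qed (simp add: pair_finite_arcs)
  have two: "card {(x, y). {x, y} = e} = 2" if "e \<in> uedges G" for e
  proof -
    obtain u v where uv: "(u, v) \<in> parcs G" "e = {u, v}" using \<open>e \<in> uedges G\<close> by (auto simp: uedges_def)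
    then have "{(x, y). {x, y} = e} = {(u, v), (v, u)}" by (auto simp: doubleton_eq_iff)
    then show ?thesis using no_loops'[OF uv(1)] by simp
  qed
  have "card (parcs G) = (\<Sum>e\<in>uedges G. card {(x, y). {x, y} = e})"
    \<comment> \<open>The fibres are finite because an infinite set would have \<open>card\<close> 0
      instead of 2.\<close>
    by (subst eq, rule card_UN_disjoint) (use fin two card.infinite in fastforce)+
  then show ?thesis using two by simp
qed

text \<open>The arcs of a complete subgraph are forced by its vertices, so counting copies amounts
  to counting vertex sets.\<close>

lemma clique_copies_eq:
  "clique_copies k G = (\<lambda>A. \<lparr>pverts = A, parcs = offdiag A\<rparr>) `
    {A. A \<subseteq> pverts G \<and> card A = k \<and> offdiag A \<subseteq> parcs G}"
proof (intro equalityI subsetI)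
  fix H assume "H \<in> clique_copies k G"
  then have "pverts H \<subseteq> pverts G \<and> parcs H \<subseteq> parcs G \<and> card (pverts H) = k \<and> parcs H = offdiag (pverts H)"
    by (auto simp: clique_copies_def subgraph_def complete_digraph_pair_def offdiag_def)
  then show "H \<in> (\<lambda>A. \<lparr>pverts = A, parcs = offdiag A\<rparr>) `
      {A. A \<subseteq> pverts G \<and> card A = k \<and> offdiag A \<subseteq> parcs G}"
    by (intro image_eqI[of _ _ "pverts H"]) auto
next
  fix H assume "H \<in> (\<lambda>A. \<lparr>pverts = A, parcs = offdiag A\<rparr>) `
      {A. A \<subseteq> pverts G \<and> card A = k \<and> offdiag A \<subseteq> parcs G}"
  then obtain A where A: "H = \<lparr>pverts = A, parcs = offdiag A\<rparr>" "A \<subseteq> pverts G" "card A = k"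
    "offdiag A \<subseteq> parcs G"
    by blast
  have "finite A" using A(2) pair_finite_verts finite_subset by blast
  then have "K\<^bsub>k\<^esub> (with_proj H)" using A by (simp add: complete_digraph_pair_def offdiag_def)
  moreover have "pair_wf_digraph H"
    unfolding A(1) by unfold_locales (auto simp: offdiag_def)
  then have "subgraph (with_proj H) (with_proj G)"
    using A wf_digraph by (auto simp: subgraph_def compatible_def wf_digraph_wp_iff)
  ultimately show "H \<in> clique_copies k G" by (simp add: clique_copies_def)
qed

lemma has_cover_iff:
  "has_cover k l G \<longleftrightarrow>
    (\<forall>x y. y \<in> nbhd x \<longrightarrow>
      l \<le> card {A. A \<subseteq> pverts G \<and> card A = k \<and> offdiag A \<subseteq> parcs G \<and> x \<in> A \<and> y \<in> A})"
proof -
  have "card {H \<in> clique_copies k G. {x, y} \<in> uedges H} =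
      card {A. A \<subseteq> pverts G \<and> card A = k \<and> offdiag A \<subseteq> parcs G \<and> x \<in> A \<and> y \<in> A}"
    if "y \<in> nbhd x" for x y
  proof -
    have "x \<noteq> y" using that by auto
    then have "{x, y} \<in> uedges \<lparr>pverts = A, parcs = offdiag A\<rparr> \<longleftrightarrow> x \<in> A \<and> y \<in> A" for A
      by (auto simp: uedges_def offdiag_def doubleton_eq_iff)
    then have "{H \<in> clique_copies k G. {x, y} \<in> uedges H} = (\<lambda>A. \<lparr>pverts = A, parcs = offdiag A\<rparr>) `
        {A. A \<subseteq> pverts G \<and> card A = k \<and> offdiag A \<subseteq> parcs G \<and> x \<in> A \<and> y \<in> A}"
      unfolding clique_copies_eq by blast
    then show ?thesis by (simp add: card_image inj_on_def)
  qed
  moreover have "(\<forall>e \<in> uedges G. P e) \<longleftrightarrow> (\<forall>x y. y \<in> nbhd x \<longrightarrow> P {x, y})" for P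
    unfolding uedges_def nbhd_def by blast
  ultimately show ?thesis by (simp add: has_cover_def)
qed

text \<open>A triangle through a given edge is determined by its third vertex, a common neighbour of
  the ends.\<close>

lemma has_cover_3_iff:
  "has_cover 3 l G \<longleftrightarrow> (\<forall>x y. y \<in> nbhd x \<longrightarrow> l \<le> card (nbhd x \<inter> nbhd y))"
proof -
  have "card {A. A \<subseteq> pverts G \<and> card A = 3 \<and> offdiag A \<subseteq> parcs G \<and> x \<in> A \<and> y \<in> A} =
      card (nbhd x \<inter> nbhd y)" if xy: "y \<in> nbhd x" for x y
  proof -
    have ne: "x \<noteq> y" using xy by auto
    have "{A. A \<subseteq> pverts G \<and> card A = 3 \<and> offdiag A \<subseteq> parcs G \<and> x \<in> A \<and> y \<in> A} =
        (\<lambda>z. {x, y, z}) ` (nbhd x \<inter> nbhd y)" (is "?L = ?R")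
    proof (intro equalityI subsetI)
      fix A assume A: "A \<in> ?L"
      then have fin: "finite A" using card.infinite by fastforce
      have "card (A - {x, y}) = 1" using A ne fin by (subst card_Diff_subset) auto
      then obtain z where z: "A - {x, y} = {z}" by (rule card_1_singletonE)
      then have eq: "A = {x, y, z}" "z \<noteq> x" "z \<noteq> y" using A by auto
      then have "(x, z) \<in> offdiag A" "(y, z) \<in> offdiag A" by (auto simp: offdiag_def)
      then have "z \<in> nbhd x \<inter> nbhd y" using A by (auto simp: nbhd_def)
      then show "A \<in> ?R" using eq by blast
    next
      fix A assume "A \<in> ?R"
      then obtain z where z: "z \<in> nbhd x" "z \<in> nbhd y" "A = {x, y, z}" by blast
      have sym: "x \<in> nbhd y" "x \<in> nbhd z" "y \<in> nbhd z" using xy z nbhd_sym by blast+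
      have "z \<noteq> x" "z \<noteq> y" using z by auto
      then have "card A = 3" using z ne by simp
      moreover have "A \<subseteq> pverts G" using z sym nbhd_subset by blast
      moreover have "offdiag A \<subseteq> parcs G" using z sym xy by (auto simp: offdiag_def nbhd_def)
      ultimately show "A \<in> ?L" using z by simp
    qed
    moreover have "inj_on (\<lambda>z. {x, y, z}) (nbhd x \<inter> nbhd y)"
    proof (rule inj_onI)
      fix z z' assume "z \<in> nbhd x \<inter> nbhd y" "z' \<in> nbhd x \<inter> nbhd y" "{x, y, z} = {x, y, z'}"
      moreover from this have "z \<noteq> x" "z \<noteq> y" by auto
      ultimately show "z = z'" by blast
    qed
    ultimately show ?thesis by (simp add: card_image)
  qed
  then show ?thesis by (simp add: has_cover_iff)
qed

lemma all_in_K4_imp_has_cover: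
  assumes "all_in_K4 (pverts G)"
  shows "has_cover 4 1 G"
  unfolding has_cover_iff
proof (intro allI impI)
  fix x y assume xy: "y \<in> nbhd x"
  then have "in_K4 x y"
    using assms nbhd_sym nbhd_subset unfolding all_in_K4_def by blast
  then obtain z w where zw: "z \<in> nbhd x" "z \<in> nbhd y" "w \<in> nbhd x" "w \<in> nbhd y" "w \<in> nbhd z"
    unfolding in_K4_def by blast
  have sym: "x \<in> nbhd y" "x \<in> nbhd z" "x \<in> nbhd w" "y \<in> nbhd z" "y \<in> nbhd w" "z \<in> nbhd w"
    using xy zw nbhd_sym by blast+
  have ne: "x \<noteq> y" "x \<noteq> z" "x \<noteq> w" "y \<noteq> z" "y \<noteq> w" "z \<noteq> w" using xy zw nbhd_irrefl by blast+
  have "{x, y, z, w} \<subseteq> pverts G" using xy zw sym nbhd_subset by blast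
  moreover have "offdiag {x, y, z, w} \<subseteq> parcs G"
    using xy zw sym by (auto simp: offdiag_def nbhd_def)
  moreover have "card {x, y, z, w} = 4" using ne by simp
  ultimately have ne': "{A. A \<subseteq> pverts G \<and> card A = 4 \<and> offdiag A \<subseteq> parcs G \<and> x \<in> A \<and> y \<in> A} \<noteq> {}" (is "?C \<noteq> {}")
    by blast
  have "finite ?C" using pair_finite_verts by (intro finite_subset[of ?C "Pow (pverts G)"]) auto
  then have "card ?C > 0" using ne' card_gt_0_iff by blast
  then show "1 \<le> card ?C" by simp
qed

end

subsection \<open>Sparse competitors\<close>

text \<open>The cliques are given by vertex sets, a form that gluing preserves. A single vertex
  without arcs qualifies and starts the construction.\<close>

definition K4_union :: "'a pair_pre_digraph \<Rightarrow> bool" where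
  "K4_union H \<longleftrightarrow> pair_graph H \<and> Digraph_Component.connected (with_proj H) \<and>
    (\<forall>(x, y) \<in> parcs H. \<exists>B. card B = 4 \<and> x \<in> B \<and> y \<in> B \<and> offdiag B \<subseteq> parcs H)"

text \<open>The other two vertices of a K4 containing an edge give two triangles on it.\<close>

lemma K4_union_connected_cover_graph:
  assumes "K4_union H"
  shows "connected_cover_graph (card (pverts H)) 3 2 H"
proof -
  interpret pair_graph H using assms by (simp add: K4_union_def)
  have "has_cover 3 2 H"
    unfolding has_cover_3_iff
  proof (intro allI impI)
    fix x y assume xy: "y \<in> nbhd x"
    then obtain B where B: "card B = 4" "x \<in> B" "y \<in> B" "offdiag B \<subseteq> parcs H"
      using assms by (auto simp: K4_union_def nbhd_def)
    have fin: "finite B" using B(1) card.infinite by fastforce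
    have "x \<noteq> y" using xy by auto
    then have "card (B - {x, y}) = 2" using B fin by (subst card_Diff_subset) auto
    moreover have "B - {x, y} \<subseteq> nbhd x \<inter> nbhd y" using B by (auto simp: offdiag_def nbhd_def)
    then have "card (B - {x, y}) \<le> card (nbhd x \<inter> nbhd y)" by (intro card_mono) auto
    ultimately show "2 \<le> card (nbhd x \<inter> nbhd y)" by simp
  qed
  then show ?thesis using assms by (simp add: connected_cover_graph_def K4_union_def)
qed

lemma K4_union_singleton: "K4_union \<lparr>pverts = {v}, parcs = {}\<rparr>"
proof -
  interpret pair_graph "\<lparr>pverts = {v}, parcs = {}\<rparr>"
    by unfold_locales (auto simp: symmetric_def sym_def)
  show ?thesis
    unfolding K4_union_def connected_iff_no_cut using pair_graph by auto
qed

text \<open>Let \<open>b\<close> be a shared vertex. A cut of the union either cuts \<open>H\<close>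
  or separates \<open>b\<close> from another vertex of \<open>B\<close>, and the new clique joins
  these two.\<close>

lemma K4_union_glue:
  assumes H: "K4_union H" and B: "card B = 4" "B \<inter> pverts H \<noteq> {}"
  shows "K4_union \<lparr>pverts = pverts H \<union> B, parcs = parcs H \<union> offdiag B\<rparr>" (is "K4_union ?H'")
proof -
  interpret H: pair_graph H using H by (simp add: K4_union_def)
  have fin: "finite B" using B(1) card.infinite by fastforce
  interpret H': pair_graph ?H'
  proof unfold_locales
    show "finite (parcs ?H')" "finite (pverts ?H')"
      using fin finite_offdiag H.pair_finite_arcs H.pair_finite_verts by auto
    show "symmetric (with_proj ?H')"
      by (auto simp: symmetric_def sym_def offdiag_def intro: H.arcs_symmetric)
  qed (auto simp: offdiag_def dest: H.in_arcsD1 H.in_arcsD2 H.no_loops')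
  have nbhd: "H'.nbhd x = H.nbhd x \<union> (if x \<in> B then B - {x} else {})" for x
    unfolding H'.nbhd_def H.nbhd_def by (auto simp: offdiag_def)
  have cutH: "\<exists>x\<in>S. \<exists>y. y \<in> H.nbhd x \<and> y \<notin> S" if "S \<subseteq> pverts H" "S \<noteq> {}" "S \<noteq> pverts H" for S
    using H that by (auto simp: K4_union_def H.connected_iff_no_cut)
  obtain b where b: "b \<in> B" "b \<in> pverts H" using B(2) by blast
  have "\<exists>x\<in>S. \<exists>y. y \<in> H'.nbhd x \<and> y \<notin> S"
    if S: "S \<subseteq> pverts H \<union> B" "S \<noteq> {}" "S \<noteq> pverts H \<union> B" for S
  proof -
    consider "S \<inter> pverts H = {}" | "pverts H \<subseteq> S"
      | "S \<inter> pverts H \<noteq> {}" "S \<inter> pverts H \<noteq> pverts H"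
      by blast
    then show ?thesis
    proof cases
      case 1
      then obtain s where s: "s \<in> S" "s \<in> B" "b \<notin> S" using S b by blast
      then have "b \<in> H'.nbhd s" using b nbhd by auto
      then show ?thesis using s by blast
    next
      case 2
      then obtain t where t: "t \<in> B" "t \<notin> S" "b \<in> S" using S b by blast
      then have "t \<in> H'.nbhd b" using b nbhd by auto
      then show ?thesis using t by blast
    next
      case 3
      then obtain x y where xy: "x \<in> S \<inter> pverts H" "y \<in> H.nbhd x" "y \<notin> S \<inter> pverts H"
        using cutH[of "S \<inter> pverts H"] by blast
      then have "y \<in> H'.nbhd x" "y \<notin> S" using nbhd H.nbhd_subset by auto
      then show ?thesis using xy by blast
    qed
  qed
  then have "Digraph_Component.connected (with_proj ?H')"
    unfolding H'.connected_iff_no_cut using b by auto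
  moreover have "\<forall>(x, y) \<in> parcs ?H'. \<exists>B. card B = 4 \<and> x \<in> B \<and> y \<in> B \<and> offdiag B \<subseteq> parcs ?H'"
  proof (intro ballI, clarify)
    fix x y assume "(x, y) \<in> parcs ?H'"
    then consider "(x, y) \<in> parcs H" | "x \<in> B" "y \<in> B" by (auto simp: offdiag_def)
    then show "\<exists>B. card B = 4 \<and> x \<in> B \<and> y \<in> B \<and> offdiag B \<subseteq> parcs ?H'"
    proof cases
      case 1
      then obtain C where "card C = 4" "x \<in> C" "y \<in> C" "offdiag C \<subseteq> parcs H"
        using H by (auto simp: K4_union_def)
      then show ?thesis by (intro exI[of _ C]) auto
    next
      case 2
      then show ?thesis using B by (intro exI[of _ B]) auto
    qed
  qed
  ultimately show ?thesis using H'.pair_graph by (simp add: K4_union_def)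
qed

text \<open>
  Up to seven vertices are covered by two copies of \<open>K\<^sub>4\<close>, sharing \<open>8 - n\<close> vertices; three more
  vertices cost six more edges.
\<close>

lemma ex_sparse_K4_union:
  assumes "finite V" "4 \<le> card V"
  shows "\<exists>H. K4_union H \<and> pverts H = V \<and> card (parcs H) + 2 \<le> 4 * card V"
  using assms
proof (induction "card V" arbitrary: V rule: less_induct)
  case less
  show ?case
  proof (cases "card V \<le> 7")
    case True
    obtain A where A: "A \<subseteq> V" "card A = 4" "finite A"
      using obtain_subset_with_card_n[OF less.prems(2)] by metis
    have "8 - card V \<le> card A" using A less.prems by simp
    then obtain C where C: "C \<subseteq> A" "card C = 8 - card V" "finite C"
      using obtain_subset_with_card_n by metis
    define B where "B = C \<union> (V - A)"
    have VA: "card (V - A) = card V - 4" using A by (simp add: card_Diff_subset)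
    have "card B = card C + card (V - A)"
      unfolding B_def using less.prems C A by (intro card_Un_disjoint) auto
    then have B: "card B = 4" "A \<inter> B = C" "A \<union> B = V" "finite B"
      using C VA A less.prems True by (auto simp: B_def)
    \<comment> \<open>The first K4 arises by gluing \<open>A\<close> onto the single vertex
      \<open>a\<close>.\<close>
    obtain a where "a \<in> A" using A by fastforce
    then have "K4_union \<lparr>pverts = A, parcs = offdiag A\<rparr>"
      using K4_union_glue[OF K4_union_singleton A(2), of a] by (simp add: insert_absorb)
    moreover have "C \<noteq> {}" using C(2) True by auto
    ultimately have "K4_union \<lparr>pverts = V, parcs = offdiag A \<union> offdiag B\<rparr>"
      using K4_union_glue[of "\<lparr>pverts = A, parcs = offdiag A\<rparr>" B] B by (simp add: Int_commute)
    moreover have "card (offdiag A \<union> offdiag B) + 2 \<le> 4 * card V"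
    proof -
      have "offdiag A \<inter> offdiag B = offdiag C" using B(2) by (auto simp: offdiag_def)
      then have "card (offdiag A) + card (offdiag B) = card (offdiag A \<union> offdiag B) + card (offdiag C)"
        using card_Un_Int[of "offdiag A" "offdiag B"] A B finite_offdiag by metis
      moreover have "card (offdiag A) = 12" "card (offdiag B) = 12"
        using card_offdiag[of A] card_offdiag[of B] A B by auto
      moreover have "card (offdiag C) + card C = card C * card C" using card_offdiag C by blast
      \<comment> \<open>Subtracting the shared arcs from 24 leaves 12, 18, 22, 24 arcs for 4, 5, 6,
        7 vertices, against the allowed 14, 18, 22, 26.\<close>
      moreover have "card V = 4 \<or> card V = 5 \<or> card V = 6 \<or> card V = 7" using True less.prems by linarith
      ultimately show ?thesis using C(2) by auto
    qed
    ultimately show ?thesis by force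
  next
    case False
    then have "3 \<le> card V" by simp
    then obtain D where D: "D \<subseteq> V" "card D = 3" "finite D"
      by (rule obtain_subset_with_card_n)
    have card: "card (V - D) = card V - 3" using D by (simp add: card_Diff_subset)
    then have "card (V - D) < card V" "4 \<le> card (V - D)" using False by auto
    then obtain H where H: "K4_union H" "pverts H = V - D" "card (parcs H) + 2 \<le> 4 * card (V - D)"
      using less.hyps less.prems(1) by blast
    have "V - D \<noteq> {}" using card False by fastforce
    \<comment> \<open>The K4 on \<open>u\<close> and \<open>D\<close> meets the smaller graph only
      in \<open>u\<close>; its 12 arcs are what three more vertices allow.\<close>
    then obtain u where u: "u \<in> V" "u \<notin> D" by blast
    have uD: "card (insert u D) = 4" using u D by simp
    have "K4_union \<lparr>pverts = pverts H \<union> insert u D, parcs = parcs H \<union> offdiag (insert u D)\<rparr>"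
      using K4_union_glue[OF H(1) uD] u H(2) by simp
    moreover have "pverts H \<union> insert u D = V" using H(2) u D by blast
    moreover have "card (parcs H \<union> offdiag (insert u D)) \<le> card (parcs H) + 12"
      using card_Un_le[of "parcs H" "offdiag (insert u D)"] card_offdiag[of "insert u D"] uD D(3) by simp
    then have "card (parcs H \<union> offdiag (insert u D)) + 2 \<le> 4 * card V"
      using H(3) card False by simp
    ultimately show ?thesis by force
  qed
qed

section \<open>Comparing the minimal graph with a sparse competitor\<close>

theorem theorem1p8:
  fixes G :: "'a pair_pre_digraph" and n :: nat
  assumes "min_connected_cover_graph n 3 2 G"
  shows "has_cover 4 1 G"
proof -
  have conn: "Digraph_Component.connected (with_proj G)" and n: "card (pverts G) = n"
    and cov: "has_cover 3 2 G" and "pair_graph G"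
    and min: "\<And>H :: 'a pair_pre_digraph. connected_cover_graph n 3 2 H \<Longrightarrow> card (uedges G) \<le> card (uedges H)"
    using assms by (auto simp: min_connected_cover_graph_def connected_cover_graph_def)
  then interpret pair_graph G by simp
  interpret double_triangle_graph G
    by unfold_locales (use cov has_cover_3_iff in blast)
  show ?thesis
  proof (cases "parcs G = {}")
    case True
    then show ?thesis by (simp add: has_cover_iff nbhd_def)
  next
    case False
    then obtain x y where xy: "y \<in> nbhd x" by (auto simp: nbhd_def)
    \<comment> \<open>An edge together with two common neighbours of its ends gives four vertices,
      enough for the competitor.\<close>
    have "2 \<le> card (nbhd x \<inter> nbhd y)" using two_triangles[OF xy] .
    moreover have "card (insert x (insert y (nbhd x \<inter> nbhd y))) = 2 + card (nbhd x \<inter> nbhd y)"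
      using xy nbhd_irrefl by (subst card_insert_disjoint) auto
    moreover have "insert x (insert y (nbhd x \<inter> nbhd y)) \<subseteq> pverts G"
      using xy nbhd_sym nbhd_subset by blast
    then have "card (insert x (insert y (nbhd x \<inter> nbhd y))) \<le> card (pverts G)"
      by (intro card_mono pair_finite_verts)
    ultimately have "4 \<le> card (pverts G)" by simp
    then obtain H where H: "K4_union H" "pverts H = pverts G" "card (parcs H) + 2 \<le> 4 * card (pverts G)"
      using ex_sparse_K4_union pair_finite_verts by metis
    have "pair_graph H" using H(1) by (simp add: K4_union_def)
    then have "card (parcs H) = 2 * card (uedges H)" by (rule pair_graph.card_parcs)
    moreover have "card (uedges G) \<le> card (uedges H)"
      using min K4_union_connected_cover_graph[OF H(1)] H(2) n by simp
    ultimately have "card (parcs G) + 2 \<le> 4 * card (pverts G)" using card_parcs H(3) by simp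
    moreover have "parcs G \<inter> pverts G \<times> pverts G = parcs G" by (auto dest: in_arcsD1 in_arcsD2)
    \<comment> \<open>Minimality gives at most \<open>4 * n - 2\<close> arcs, so the excess is at
      most 2.\<close>
    ultimately have "excess (pverts G) < 4" by (simp add: excess_def)
    moreover have "excess (pverts G) \<ge> 4 \<or> all_in_K4 (pverts G)"
      using conn by (intro excess_ge_4_or_all_in_K4) (auto simp: connected_iff_no_cut)
    ultimately show ?thesis using all_in_K4_imp_has_cover by simp
  qed
qed

end
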